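(* For every finite simple graph $G$, $Z_f^+(G) = a_\star^+(G)$.
   Context: For $r\in\mathbb{N}$, the $r$-blowup $G^{(r)}$ is obtained by replacing each vertex $u$ of $G$ by an independent set $R_u$ of $r$ vertices (a cluster) and each edge $uw$ by all edges between $R_u$ and $R_w$. $r$-fold PSD forcing game: an initial set $B\subseteq V(G^{(r)})$ is blue, the rest white. A forcing process is a sequence of steps. In an ordinary step, with $B_t$ the current blue set and $W_1,\dots,W_h$ the vertex sets of the connected components of $G^{(r)}-B_t$, a vertex $u\in B_t$ with $|N(u)\cap W_i|\le r$ for some $i$ colors all of $N(u)\cap W_i$ blue. Forcing processes may also use backforcing steps: if a vertex of a cluster $R_u$ that is not entirely blue has just performed a force, then at the next step all vertices of $R_u$ may be colored blue. $B$ is an $r$-fold PSD forcing set if some forcing process makes all of $G^{(r)}$ blue. $Z_{(r)}^+(G)$ is the minimum cardinality of such a set, and $Z_f^+(G)=\inf_{r\in\mathbb{N}}Z_{(r)}^+(G)/r$. A cluster is forced at a step if some of its vertices turn from white to blue at that step. Relative to a coloring, a cluster is an All cluster (all vertices blue), a One cluster (exactly one vertex blue) or a None cluster (all white). An AON $r$-fold PSD forcing set is an $r$-fold PSD forcing set $B$ for which every cluster of $G^{(r)}$ colored with $B$ is an All, One or None cluster; $a(B)$ and $\ell(B)$ denote its numbers of All and One clusters. An optimal AON $r$-fold PSD forcing set is an AON $r$-fold PSD forcing set of cardinality $Z_{(r)}^+(G)$ for which there exists a forcing process starting from it in which exactly one cluster is forced at each step. For $G$ with $n$ vertices, optimal AON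 $n$-fold PSD forcing sets exist and all have the same number of All clusters; this number is denoted $a_\star^+(G)$. *)

theory Defs
  imports Complex_Main
begin

definition simple_graph :: "'a set \<Rightarrow> 'a rel \<Rightarrow> bool" where
  "simple_graph V E \<longleftrightarrow> finite V \<and> E \<subseteq> V \<times> V \<and> sym E \<and> irrefl E"

definition components :: "'v set \<Rightarrow> 'v rel \<Rightarrow> 'v set set" where
  "components V E = V // (Restr E V)\<^sup>*"

definition cluster :: "nat \<Rightarrow> 'a \<Rightarrow> ('a \<times> nat) set" where
  "cluster r u = {u} \<times> {..<r}"

definition blowup_verts :: "'a set \<Rightarrow> nat \<Rightarrow> ('a \<times> nat) set" where
  "blowup_verts V r = (\<Union>u\<in>V. cluster r u)"

definition blowup_edges :: "'a rel \<Rightarrow> nat \<Rightarrow> ('a \<times> nat) rel" where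
  "blowup_edges E r = (\<Union>(u, w)\<in>E. cluster r u \<times> cluster r w)"

text \<open>
  A state of the game is a pair of the current blue set and a record of who may backforce:
  \<open>Some u\<close> if the step just taken was an ordinary one, performed by a vertex of the
  cluster of \<open>u\<close>, and \<open>None\<close> at the start or just after a backforcing step.
  A force has to turn at least one white vertex blue. Without this proviso, a single blue
  vertex of the edgeless blowup of a one-vertex graph would vacuously force and then
  backforce its entire cluster.
\<close>

type_synonym 'a state = "('a \<times> nat) set \<times> 'a option"

inductive psd_step :: "'a set \<Rightarrow> 'a rel \<Rightarrow> nat \<Rightarrow> 'a state \<Rightarrow> 'a state \<Rightarrow> bool"
  for V :: "'a set" and E :: "'a rel" and r :: nat where
  force:
    "\<lbrakk>x \<in> B;
      W \<in> components (blowup_verts V r - B) (blowup_edges E r);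
      F = blowup_edges E r `` {x} \<inter> W;
      F \<noteq> {}; card F \<le> r\<rbrakk>
     \<Longrightarrow> psd_step V E r (B, p) (B \<union> F, Some (fst x))"
| backforce:
    "\<not> cluster r u \<subseteq> B \<Longrightarrow> psd_step V E r (B, Some u) (B \<union> cluster r u, None)"

definition psd_forcing_set :: "'a set \<Rightarrow> 'a rel \<Rightarrow> nat \<Rightarrow> ('a \<times> nat) set \<Rightarrow> bool" where
  "psd_forcing_set V E r B \<longleftrightarrow>
     B \<subseteq> blowup_verts V r \<and>
     (\<exists>p. (psd_step V E r)\<^sup>*\<^sup>* (B, None) (blowup_verts V r, p))"

definition psd_forcing_number :: "'a set \<Rightarrow> 'a rel \<Rightarrow> nat \<Rightarrow> nat" where
  "psd_forcing_number V E r = Min (card ` {B. psd_forcing_set V E r B})"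

definition fractional_psd_forcing_number :: "'a set \<Rightarrow> 'a rel \<Rightarrow> real" where
  "fractional_psd_forcing_number V E =
     (INF r\<in>{1..}. real (psd_forcing_number V E r) / real r)"

definition all_cluster :: "nat \<Rightarrow> ('a \<times> nat) set \<Rightarrow> 'a \<Rightarrow> bool" where
  "all_cluster r B u \<longleftrightarrow> cluster r u \<subseteq> B"

definition one_cluster :: "nat \<Rightarrow> ('a \<times> nat) set \<Rightarrow> 'a \<Rightarrow> bool" where
  "one_cluster r B u \<longleftrightarrow> card (cluster r u \<inter> B) = 1"

definition none_cluster :: "nat \<Rightarrow> ('a \<times> nat) set \<Rightarrow> 'a \<Rightarrow> bool" where
  "none_cluster r B u \<longleftrightarrow> cluster r u \<inter> B = {}"

definition num_all :: "'a set \<Rightarrow> nat \<Rightarrow> ('a \<times> nat) set \<Rightarrow> nat" where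
  "num_all V r B = card {u \<in> V. all_cluster r B u}"

definition aon_psd_forcing_set :: "'a set \<Rightarrow> 'a rel \<Rightarrow> nat \<Rightarrow> ('a \<times> nat) set \<Rightarrow> bool" where
  "aon_psd_forcing_set V E r B \<longleftrightarrow>
     psd_forcing_set V E r B \<and>
     (\<forall>u\<in>V. all_cluster r B u \<or> one_cluster r B u \<or> none_cluster r B u)"

definition single_cluster_step :: "'a set \<Rightarrow> 'a rel \<Rightarrow> nat \<Rightarrow> 'a state \<Rightarrow> 'a state \<Rightarrow> bool" where
  "single_cluster_step V E r s t \<longleftrightarrow>
     psd_step V E r s t \<and> (\<exists>!u. u \<in> V \<and> cluster r u \<inter> (fst t - fst s) \<noteq> {})"

definition optimal_aon_psd_forcing_set :: "'a set \<Rightarrow> 'a rel \<Rightarrow> nat \<Rightarrow> ('a \<times> nat) set \<Rightarrow> bool" where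
  "optimal_aon_psd_forcing_set V E r B \<longleftrightarrow>
     aon_psd_forcing_set V E r B \<and>
     card B = psd_forcing_number V E r \<and>
     (\<exists>p. (single_cluster_step V E r)\<^sup>*\<^sup>* (B, None) (blowup_verts V r, p))"

text \<open>
  Well-defined only because every graph has an optimal AON set for \<open>r = card V\<close> and all
  such sets have the same number of All clusters; establishing this is left to the proofs.
\<close>

definition a_star :: "'a set \<Rightarrow> 'a rel \<Rightarrow> nat" where
  "a_star V E =
     (THE k. \<exists>B. optimal_aon_psd_forcing_set V E (card V) B \<and> num_all V (card V) B = k)"

end

theory Submission
  imports Defs
begin

text \<open>
  At the level of clusters only the set \<open>A\<close> of full clusters matters: a vertex \<open>u\<close>, full or allowed
  to be a One, forces \<open>w\<close> if \<open>w\<close> is its only neighbour in its component of \<open>G - A\<close>, and then both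
  become full. Let \<open>f\<close> be the least number of initially full clusters when all Ones are free.
  If a force in the blowup fills the clusters of a set \<open>D\<close>, these contained at least
  \<open>(|D| - 1) r\<close> blue vertices, which pays for making all but one of them All from the start. Hence
  each \<open>r\<close>-fold forcing set can be replaced by an AON one that is no larger, so that
  \<open>r f \<le> Z\<^sub>r \<le> r f + n\<close>, the upper bound for \<open>r \<ge> 2\<close> or \<open>r = n\<close> (for \<open>r = 1\<close>
  a One is already an All cluster) and strict for nonempty \<open>G\<close>. The infimum of
  \<open>Z\<^sub>r / r\<close> is therefore \<open>f\<close>. For \<open>r = n\<close> the bounds also determine the number of All clusters
  of an optimal AON set, except that \<open>n\<close> One clusters and no All cluster might occur with \<open>f = 1\<close>.
  There the first force already needs a One, so that no budget is left for an All cluster.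
\<close>

section \<open>The game on clusters\<close>

definition full :: "'a set \<Rightarrow> nat \<Rightarrow> ('a \<times> nat) set \<Rightarrow> 'a set" where
  "full V r X = {v \<in> V. cluster r v \<subseteq> X}"

text \<open>Reflexive at every point, even outside \<open>U\<close>; membership in \<open>U\<close>
  follows only from a nontrivial path.\<close>

abbreviation reach :: "'v set \<Rightarrow> 'v rel \<Rightarrow> 'v rel" where
  "reach U R \<equiv> (Restr R U)\<^sup>*"

text \<open>\<open>L\<close> holds the clusters allowed a One. It stays fixed because a One that has
  been used belongs to \<open>A\<close> from then on. A step with \<open>u\<close> outside
  \<open>A\<close> stands for a force followed by backforcing.\<close>

inductive cluster_forcing :: "'a set \<Rightarrow> 'a rel \<Rightarrow> 'a set \<Rightarrow> 'a set \<Rightarrow> bool"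
  for V :: "'a set" and E :: "'a rel" and L :: "'a set" where
  finished: "cluster_forcing V E L V"
| step: "\<lbrakk>u \<in> A \<union> L; w \<in> V - A; E `` {u} \<inter> reach (V - A) E `` {w} = {w};
      cluster_forcing V E L (insert u (insert w A))\<rbrakk> \<Longrightarrow> cluster_forcing V E L A"

lemma cluster_forcing_mono:
  "cluster_forcing V E L A \<Longrightarrow> L \<subseteq> L' \<Longrightarrow> cluster_forcing V E L' A"
proof (induction rule: cluster_forcing.induct)
  case (step u A w)
  show ?case by (rule cluster_forcing.step[of u _ _ w]) (use step in auto)
qed (rule cluster_forcing.finished)

text \<open>\<open>A\<close> only grows, so a vertex of \<open>M\<close> may force at every later
  step by being full, which makes its One redundant.\<close>

lemma cluster_forcing_Diff:
  "cluster_forcing V E L A \<Longrightarrow> M \<subseteq> A \<Longrightarrow> cluster_forcing V E (L - M) A"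
proof (induction rule: cluster_forcing.induct)
  case (step u A v)
  show ?case by (rule cluster_forcing.step[of u _ _ v]) (use step in auto)
qed (rule cluster_forcing.finished)

section \<open>Reachability and components\<close>

lemma reach_sym: "sym R \<Longrightarrow> sym (reach U R)"
  by (rule sym_rtrancl) (auto simp: sym_def)

lemma component_eq:
  assumes "W \<in> components U R" "y \<in> W" "sym R"
  shows "W = reach U R `` {y}" and "y \<in> U"
proof -
  obtain z where z: "z \<in> U" "W = reach U R `` {z}"
    using assms(1) by (auto simp: components_def quotient_def)
  have zy: "(z, y) \<in> reach U R" using z assms(2) by auto
  then have yz: "(y, z) \<in> reach U R" using reach_sym[OF assms(3)] by (meson symD)
  show "W = reach U R `` {y}" using z zy yz by (auto intro: rtrancl_trans)
  show "y \<in> U" using zy z(1) by (induction rule: rtrancl_induct) auto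
qed

lemma reach_nontrivial:
  assumes "(a, b) \<in> reach U R" "a \<noteq> b" "sym R"
  shows "\<exists>c\<in>U. (a, c) \<in> R" "\<exists>c\<in>U. (b, c) \<in> R" "a \<in> U" "b \<in> U"
proof -
  obtain c d where "(a, c) \<in> Restr R U" "(d, b) \<in> Restr R U"
    using assms(1,2) by (metis converse_rtranclE rtranclE)
  then show "\<exists>c\<in>U. (a, c) \<in> R" "\<exists>c\<in>U. (b, c) \<in> R" "a \<in> U" "b \<in> U"
    using symD[OF assms(3)] by auto
qed

section \<open>Blowups and their clusters\<close>

lemma blowup_verts_eq: "blowup_verts V r = V \<times> {..<r}"
  by (auto simp: blowup_verts_def cluster_def)

lemma mem_cluster: "(v, i) \<in> cluster r u \<longleftrightarrow> v = u \<and> i < r"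
  by (auto simp: cluster_def)

lemma blowup_edges_iff:
  "((u, i), (w, j)) \<in> blowup_edges E r \<longleftrightarrow> (u, w) \<in> E \<and> i < r \<and> j < r"
  by (auto simp: blowup_edges_def cluster_def)

lemma finite_cluster [simp]: "finite (cluster r u)"
  by (simp add: cluster_def)

lemma card_cluster [simp]: "card (cluster r u) = r"
  by (simp add: cluster_def card_cartesian_product)

lemma full_subset: "full V r X \<subseteq> V"
  by (auto simp: full_def)

lemma full_mono: "X \<subseteq> Y \<Longrightarrow> full V r X \<subseteq> full V r Y"
  by (auto simp: full_def)

lemma full_blowup_verts [simp]: "full V r (blowup_verts V r) = V"
  by (auto simp: full_def blowup_verts_def)

locale sgraph =
  fixes V :: "'a set" and E :: "'a rel"
  assumes simple: "simple_graph V E"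
begin

lemma fin: "finite V" and edges: "E \<subseteq> V \<times> V" and symE: "sym E"
  and irr: "(u, u) \<notin> E"
  using simple by (auto simp: simple_graph_def irrefl_def)

lemma edge_sym: "(u, w) \<in> E \<Longrightarrow> (w, u) \<in> E"
  using symE by (meson symD)

lemma sym_blowup_edges: "sym (blowup_edges E r)"
  by (rule symI) (auto simp: blowup_edges_iff dest: edge_sym)

lemma finite_blowup_verts: "finite (blowup_verts V r)"
  by (simp add: blowup_verts_eq fin)

section \<open>White components of the blowup\<close>

abbreviation white :: "nat \<Rightarrow> ('a \<times> nat) set \<Rightarrow> ('a \<times> nat) set" where
  "white r X \<equiv> blowup_verts V r - X"

lemma white_not_full: "(v, i) \<in> white r X \<Longrightarrow> v \<in> V - full V r X"
  by (auto simp: full_def blowup_verts_eq cluster_def)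

lemma not_full_white: "v \<in> V - full V r X \<Longrightarrow> \<exists>i. (v, i) \<in> white r X"
  by (auto simp: full_def blowup_verts_eq cluster_def)

lemma reach_project:
  assumes "(x, y) \<in> reach (white r X) (blowup_edges E r)"
  shows "(fst x, fst y) \<in> reach (V - full V r X) E"
  using assms
proof (induction rule: rtrancl_induct)
  case (step y z)
  then have "(fst y, fst z) \<in> Restr E (V - full V r X)"
    using white_not_full[of "fst y" "snd y"] white_not_full[of "fst z" "snd z"]
    by (cases y; cases z) (auto simp: blowup_edges_iff)
  with step.IH show ?case by (rule rtrancl_into_rtrancl)
qed auto

text \<open>The path must be nonempty because white vertices of one cluster are joined only through
  a neighbouring cluster. It lifts since every cluster on it retains a white vertex.\<close>

lemma reach_lift:
  assumes "(a, b) \<in> (Restr E (V - full V r X))\<^sup>+" "(a, i) \<in> white r X" "(b, j) \<in> white r X"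
  shows "((a, i), (b, j)) \<in> reach (white r X) (blowup_edges E r)"
  using assms(1,3)
proof (induction arbitrary: j rule: trancl_induct)
  case (base b)
  then show ?case using assms(2) by (auto simp: blowup_edges_iff blowup_verts_eq)
next
  case (step b c)
  obtain k where k: "(b, k) \<in> white r X" using step.hyps not_full_white by blast
  have "((b, k), (c, j)) \<in> Restr (blowup_edges E r) (white r X)"
    using k step.hyps step.prems by (auto simp: blowup_edges_iff blowup_verts_eq)
  with step.IH[OF k] show ?case by (rule rtrancl_into_rtrancl)
qed

text \<open>No edge from \<open>(w, j)\<close> ends in a white vertex. The white vertices of such a
  cluster are therefore components by themselves and can be forced only one at a time.\<close>

lemma component_isolated:
  assumes "E `` {w} \<subseteq> full V r X"
  shows "reach (white r X) (blowup_edges E r) `` {(w, j)} = {(w, j)}"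
proof -
  have "y = (w, j)" if "((w, j), y) \<in> reach (white r X) (blowup_edges E r)" for y
    using that
  proof (cases rule: converse_rtranclE)
    case (step z)
    then have "(w, fst z) \<in> E" "fst z \<notin> full V r X"
      using white_not_full[of "fst z" "snd z"] by (cases z; auto simp: blowup_edges_iff)+
    then show ?thesis using assms by auto
  qed auto
  then show ?thesis by auto
qed

text \<open>As soon as one neighbouring cluster is not full, the white vertices over
  \<open>w\<close> are joined through it, and the component is the whole white preimage of a
  component of the graph minus the full clusters.\<close>

lemma component_not_isolated:
  assumes "(w, j) \<in> white r X" "\<not> E `` {w} \<subseteq> full V r X"
  shows "reach (white r X) (blowup_edges E r) `` {(w, j)}
    = {y \<in> white r X. fst y \<in> reach (V - full V r X) E `` {w}}" (is "?L = ?R")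
proof
  have "y \<in> white r X" if "((w, j), y) \<in> reach (white r X) (blowup_edges E r)" for y
    using that assms(1) by (induction rule: rtrancl_induct) auto
  then show "?L \<subseteq> ?R" using reach_project by fastforce
next
  obtain c where "(w, c) \<in> E" "c \<notin> full V r X" using assms(2) by auto
  then have c: "(w, c) \<in> Restr E (V - full V r X)" "(c, w) \<in> Restr E (V - full V r X)"
    using edges white_not_full[OF assms(1)] edge_sym by auto
  show "?R \<subseteq> ?L"
  proof
    fix y assume y: "y \<in> ?R"
    \<comment> \<open>The detour to \<open>c\<close> and back is the nonempty path that
      \<open>reach_lift\<close> needs for other white vertices over \<open>w\<close>.\<close>
    have "(w, w) \<in> (Restr E (V - full V r X))\<^sup>+"
      using c by (meson trancl.intros)
    then have "(w, fst y) \<in> (Restr E (V - full V r X))\<^sup>+"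
      using y by (cases "fst y = w") (auto simp: rtrancl_eq_or_trancl)
    then show "y \<in> ?L" using reach_lift[of w "fst y" r X j "snd y"] y assms(1) by auto
  qed
qed

section \<open>From the cluster game to processes in the blowup\<close>

lemma single_cluster_stepI:
  assumes "psd_step V E r s t" "u \<in> V" "fst t = fst s \<union> F" "F \<subseteq> cluster r u" "\<not> F \<subseteq> fst s"
  shows "single_cluster_step V E r s t"
  unfolding single_cluster_step_def
proof (intro conjI ex1I[of _ u])
  fix v assume "v \<in> V \<and> cluster r v \<inter> (fst t - fst s) \<noteq> {}"
  then show "v = u" using assms(3,4) by (auto simp: cluster_def)
next
  show "cluster r u \<inter> (fst t - fst s) \<noteq> {}" using assms(3-5) by blast
qed (use assms(1,2) in simp_all)

text \<open>The white vertices over \<open>w\<close> are single components here, so \<open>x\<close>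
  forces them one after another; the induction is on their number.\<close>

lemma force_isolated:
  assumes "x \<in> X" "fst x = u" "snd x < r" "(u, w) \<in> E" "E `` {w} \<subseteq> full V r X"
  shows "\<exists>q. (single_cluster_step V E r)\<^sup>*\<^sup>* (X, p) (X \<union> cluster r w, q)"
  using assms
proof (induction "card (cluster r w - X)" arbitrary: X p rule: less_induct)
  case less
  show ?case
  proof (cases "cluster r w \<subseteq> X")
    case True
    then have "X \<union> cluster r w = X" by auto
    then show ?thesis by auto
  next
    case False
    then obtain j where j: "j < r" "(w, j) \<notin> X" by (auto simp: cluster_def)
    have w: "w \<in> V" using less.prems edges by auto
    have "(w, j) \<in> white r X" using j w by (auto simp: blowup_verts_eq)
    then have W: "{(w, j)} \<in> components (white r X) (blowup_edges E r)"
      using component_isolated[OF less.prems(5), of j] quotientI unfolding components_def by metis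
    have F: "{(w, j)} = blowup_edges E r `` {x} \<inter> {(w, j)}"
      using less.prems j by (cases x) (auto simp: blowup_edges_iff)
    have "psd_step V E r (X, p) (X \<union> {(w, j)}, Some (fst x))"
      by (rule psd_step.force[OF less.prems(1) W F]) (use j in auto)
    then have 1: "single_cluster_step V E r (X, p) (X \<union> {(w, j)}, Some (fst x))"
      by (rule single_cluster_stepI[OF _ w, where F = "{(w, j)}"]) (use j in \<open>simp_all add: mem_cluster\<close>)
    have "card (cluster r w - (X \<union> {(w, j)})) < card (cluster r w - X)"
    proof (rule psubset_card_mono)
      have "(w, j) \<in> cluster r w - X" using j by (simp add: mem_cluster)
      then show "cluster r w - (X \<union> {(w, j)}) \<subset> cluster r w - X" by blast
    qed simp
    moreover have "E `` {w} \<subseteq> full V r (X \<union> {(w, j)})"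
      using less.prems(5) full_mono[of X "X \<union> {(w, j)}" V r] by auto
    ultimately obtain q where "(single_cluster_step V E r)\<^sup>*\<^sup>* (X \<union> {(w, j)}, Some (fst x))
        (X \<union> {(w, j)} \<union> cluster r w, q)"
      using less.hyps[of "X \<union> {(w, j)}" "Some (fst x)"] less.prems by blast
    moreover have "X \<union> {(w, j)} \<union> cluster r w = X \<union> cluster r w"
      using j by (auto simp: mem_cluster)
    ultimately show ?thesis using converse_rtranclp_into_rtranclp[of "single_cluster_step V E r", OF 1]
      by auto
  qed
qed

text \<open>All white vertices over \<open>w\<close> lie in one component, where \<open>x\<close>
  has no further white neighbours by the uniqueness of the target. The force thus stays within one
  cluster, which also gives the bound \<open>r\<close>.\<close>

lemma force_not_isolated:
  assumes "x \<in> X" "fst x = u" "snd x < r" "w \<in> V - full V r X"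
    and "E `` {u} \<inter> reach (V - full V r X) E `` {w} = {w}" "\<not> E `` {w} \<subseteq> full V r X"
  shows "single_cluster_step V E r (X, p) (X \<union> cluster r w, Some u)"
proof -
  obtain j where j: "(w, j) \<in> white r X" using assms(4) not_full_white by blast
  let ?W = "reach (white r X) (blowup_edges E r) `` {(w, j)}"
  have W: "?W \<in> components (white r X) (blowup_edges E r)"
    using j quotientI unfolding components_def by metis
  have uw: "(u, w) \<in> E" using assms(5) by auto
  have key: "(u, d) \<in> E \<and> d \<in> reach (V - full V r X) E `` {w} \<longleftrightarrow> d = w" for d
    using assms(5) by blast
  have F: "cluster r w - X = blowup_edges E r `` {x} \<inter> ?W"
  proof (rule set_eqI)
    fix y
    have "y \<in> blowup_edges E r `` {x} \<longleftrightarrow> (u, fst y) \<in> E \<and> snd y < r"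
      using assms(2,3) by (cases x; cases y) (simp add: blowup_edges_iff)
    moreover have "y \<in> cluster r w \<longleftrightarrow> fst y = w \<and> snd y < r"
      by (cases y) (simp add: mem_cluster)
    moreover have "y \<in> blowup_verts V r \<longleftrightarrow> fst y \<in> V \<and> snd y < r"
      by (cases y) (simp add: blowup_verts_eq)
    ultimately show "y \<in> cluster r w - X \<longleftrightarrow> y \<in> blowup_edges E r `` {x} \<inter> ?W"
      unfolding component_not_isolated[OF j assms(6)] using key[of "fst y"] assms(4) by blast
  qed
  have "psd_step V E r (X, p) (X \<union> (cluster r w - X), Some (fst x))"
  proof (rule psd_step.force[OF assms(1) W F])
    show "cluster r w - X \<noteq> {}" using j by (auto simp: cluster_def blowup_verts_eq)
    show "card (cluster r w - X) \<le> r"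
      by (metis card_cluster card_mono Diff_subset finite_cluster)
  qed
  then have "psd_step V E r (X, p) (X \<union> cluster r w, Some u)" using assms(2) by simp
  then show ?thesis
    by (rule single_cluster_stepI[where u = w and F = "cluster r w"])
      (use assms(4) in \<open>auto simp: full_def\<close>)
qed

text \<open>The Ones sit at index \<open>0\<close>. A cluster step becomes one or more forces by
  \<open>(u, 0)\<close> on the cluster of \<open>w\<close>, then backforcing if \<open>u\<close> was
  only a One. For \<open>2 \<le> r\<close> a One is not full, so the full clusters are exactly those
  of \<open>A\<close>.\<close>

lemma cluster_forcing_to_process:
  assumes "cluster_forcing V E L A" "A \<subseteq> V" "L \<subseteq> V" "2 \<le> r \<or> r = card V"
  shows "\<exists>q. (single_cluster_step V E r)\<^sup>*\<^sup>* (A \<times> {..<r} \<union> L \<times> {0}, p) (blowup_verts V r, q)"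
  using assms(1,2)
proof (induction arbitrary: p rule: cluster_forcing.induct)
  case finished
  have "V = {} \<or> 0 < r" using assms(4) fin by (auto simp: card_gt_0_iff)
  then have "V \<times> {..<r} \<union> L \<times> {0} = blowup_verts V r"
    using assms(3) by (auto simp: blowup_verts_eq)
  then show ?case by auto
next
  case (step u A w)
  let ?X = "A \<times> {..<r} \<union> L \<times> {0}"
  have uw: "(u, w) \<in> E" "u \<in> V" "w \<in> V" "u \<noteq> w"
    using step.hyps edges irr by blast+
  \<comment> \<open>A force involves two distinct vertices, so the alternative
    \<open>r = card V\<close> also gives \<open>2 \<le> r\<close>.\<close>
  have "card {u, w} \<le> card V" by (rule card_mono) (use fin uw in auto)
  then have r: "2 \<le> r" using assms(4) uw by auto
  have full: "full V r ?X = A"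
  proof -
    have "v \<in> A" if "cluster r v \<subseteq> ?X" for v
    proof -
      have "(v, 1) \<in> cluster r v" using r by (simp add: mem_cluster)
      then show ?thesis using that by auto
    qed
    moreover have "cluster r v \<subseteq> ?X" if "v \<in> A" for v using that by (auto simp: cluster_def)
    ultimately show ?thesis using step.prems unfolding full_def by blast
  qed
  have x: "(u, 0) \<in> ?X" "fst (u, 0::nat) = u" "snd (u, 0::nat) < r" using r step.hyps by auto
  have "\<exists>q. (single_cluster_step V E r)\<^sup>*\<^sup>* (?X, p) (insert u (insert w A) \<times> {..<r} \<union> L \<times> {0}, q)"
  proof (cases "E `` {w} \<subseteq> A")
    case True
    \<comment> \<open>As a neighbour of \<open>w\<close>, the forcing vertex is already full, so no
      backforcing is due.\<close>
    then have "u \<in> A" using uw edge_sym by auto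
    then have "?X \<union> cluster r w = insert u (insert w A) \<times> {..<r} \<union> L \<times> {0}"
      by (auto simp: cluster_def)
    then show ?thesis using force_isolated[OF x uw(1)] True full by metis
  next
    case False
    then have 1: "single_cluster_step V E r (?X, p) (?X \<union> cluster r w, Some u)"
      using force_not_isolated[OF x] step.hyps full by metis
    show ?thesis
    proof (cases "u \<in> A")
      case True
      then have "?X \<union> cluster r w = insert u (insert w A) \<times> {..<r} \<union> L \<times> {0}"
        by (auto simp: cluster_def)
      then show ?thesis using 1 by (metis r_into_rtranclp)
    next
      case False
      have not: "\<not> cluster r u \<subseteq> ?X \<union> cluster r w"
      proof -
        have "(u, 1) \<in> cluster r u" "(u, 1) \<notin> ?X \<union> cluster r w"
          using False uw r by (auto simp: cluster_def)
        then show ?thesis by blast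
      qed
      then have "psd_step V E r (?X \<union> cluster r w, Some u) (?X \<union> cluster r w \<union> cluster r u, None)"
        by (rule psd_step.backforce)
      then have "single_cluster_step V E r (?X \<union> cluster r w, Some u)
          (?X \<union> cluster r w \<union> cluster r u, None)"
        by (rule single_cluster_stepI[where u = u and F = "cluster r u"]) (use uw not in auto)
      moreover have "?X \<union> cluster r w \<union> cluster r u = insert u (insert w A) \<times> {..<r} \<union> L \<times> {0}"
        by (auto simp: cluster_def)
      ultimately have "(single_cluster_step V E r)\<^sup>*\<^sup>* (?X, p)
          (insert u (insert w A) \<times> {..<r} \<union> L \<times> {0}, None)"
        using 1 by (metis (no_types, lifting) r_into_rtranclp rtranclp.rtrancl_into_rtrancl)
      then show ?thesis by blast
    qed
  qed
  moreover have "insert u (insert w A) \<subseteq> V" using uw step.prems by auto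
  ultimately show ?case using step.IH by (meson rtranclp_trans)
qed

lemma single_cluster_psd:
  "(single_cluster_step V E r)\<^sup>*\<^sup>* s t \<Longrightarrow> (psd_step V E r)\<^sup>*\<^sup>* s t"
  by (rule rtranclp_mono[THEN predicate2D]) (auto simp: single_cluster_step_def)

section \<open>From processes in the blowup to the cluster game\<close>

lemma card_eq_sum_clusters:
  assumes "X \<subseteq> blowup_verts V r"
  shows "card X = (\<Sum>v\<in>V. card (cluster r v \<inter> X))"
proof -
  have "(\<Union>v\<in>V. cluster r v \<inter> X) = X" using assms by (auto simp: blowup_verts_def)
  moreover have "card (\<Union>v\<in>V. cluster r v \<inter> X) = (\<Sum>v\<in>V. card (cluster r v \<inter> X))"
    by (rule card_UN_disjoint) (use fin in \<open>auto simp: cluster_def\<close>)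
  ultimately show ?thesis by simp
qed

text \<open>Except over isolated vertices, components consist of whole white parts of clusters.
  Hence a force either colors a single vertex or completes every cluster that it touches.\<close>

lemma force_effect:
  assumes "x \<in> X" "W \<in> components (white r X) (blowup_edges E r)"
    and "F = blowup_edges E r `` {x} \<inter> W" "(w, j) \<in> F" "fst x = u"
  shows "(u, w) \<in> E" "w \<in> V - full V r X" "x \<in> cluster r u" "(w, j) \<in> white r X"
    and "E `` {w} \<subseteq> full V r X \<Longrightarrow> F = {(w, j)}"
    and "\<not> E `` {w} \<subseteq> full V r X \<Longrightarrow>
      F = (\<Union>d \<in> E `` {u} \<inter> reach (V - full V r X) E `` {w}. cluster r d - X)"
proof -
  have W: "W = reach (white r X) (blowup_edges E r) `` {(w, j)}" "(w, j) \<in> white r X"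
    using component_eq[OF assms(2) _ sym_blowup_edges] assms(3,4) by auto
  then show "(w, j) \<in> white r X" "w \<in> V - full V r X" using white_not_full by auto
  show "(u, w) \<in> E" "x \<in> cluster r u"
    using assms(3,4,5) by (cases x; auto simp: blowup_edges_iff mem_cluster)+
  show "F = {(w, j)}" if "E `` {w} \<subseteq> full V r X"
    using W component_isolated[OF that] assms(3,4) by auto
  show "F = (\<Union>d \<in> E `` {u} \<inter> reach (V - full V r X) E `` {w}. cluster r d - X)"
    if "\<not> E `` {w} \<subseteq> full V r X"
    unfolding assms(3) W(1) component_not_isolated[OF W(2) that]
    using \<open>x \<in> cluster r u\<close> edges
    by (cases x) (auto simp: blowup_edges_iff mem_cluster blowup_verts_eq)
qed

text \<open>
  The induction runs backwards along the process. \<open>A\<close> is the set of clusters already full in the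
  cluster game; it may be ahead of the blowup, but only by vertices that are isolated in what remains.
  Since clusters outside \<open>A\<close> still have their initial blue vertices, each of these is spent only once.
\<close>

lemma process_to_cluster_forcing:
  assumes "(psd_step V E r)\<^sup>*\<^sup>* s (blowup_verts V r, q)"
    and "full V r (fst s) \<subseteq> A" "A \<subseteq> V"
    and "\<forall>v \<in> A - full V r (fst s). E `` {v} \<subseteq> full V r (fst s)"
    and "\<forall>u. snd s = Some u \<longrightarrow> u \<in> A"
  shows "\<exists>S L. S \<subseteq> V - A \<and> L \<subseteq> V - A \<and> S \<inter> L = {} \<and> cluster_forcing V E L (A \<union> S)
    \<and> r * card S + card L \<le> (\<Sum>v \<in> V - A. card (cluster r v \<inter> fst s))
    \<and> (A = {} \<longrightarrow> V = {} \<or> L \<noteq> {})"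
  using assms
proof (induction arbitrary: A rule: converse_rtranclp_induct)
  case base
  then have "A = V" by auto
  then show ?case by (intro exI[of _ "{}"]) (auto intro: cluster_forcing.finished)
next
  case (step s t)
  from step.hyps(1) show ?case
  proof cases
    case (backforce u X)
    \<comment> \<open>The cluster game has already made \<open>u\<close> full, so backforcing
      changes nothing outside \<open>A\<close>.\<close>
    have u: "u \<in> A" using step.prems(4) backforce by auto
    have sub: "full V r (X \<union> cluster r u) \<subseteq> insert u (full V r X)"
      by (fastforce simp: full_def cluster_def)
    have "full V r (fst t) \<subseteq> A" using sub u step.prems(1) backforce by auto
    moreover have "\<forall>v \<in> A - full V r (fst t). E `` {v} \<subseteq> full V r (fst t)"
      using step.prems(3) backforce full_mono[of X "X \<union> cluster r u" V r] by fastforce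
    moreover have "(\<Sum>v \<in> V - A. card (cluster r v \<inter> fst t)) = (\<Sum>v \<in> V - A. card (cluster r v \<inter> fst s))"
    proof (rule sum.cong[OF refl])
      fix v assume "v \<in> V - A"
      then have "cluster r v \<inter> fst t = cluster r v \<inter> fst s"
        using u backforce by (auto simp: cluster_def)
      then show "card (cluster r v \<inter> fst t) = card (cluster r v \<inter> fst s)" by simp
    qed
    ultimately show ?thesis using step.IH[of A] step.prems(2) backforce by auto
  next
    case (force x X W F p)
    define u where "u = fst x"
    obtain w j where wj: "(w, j) \<in> F" using force by fastforce
    let ?f = "full V r X"
    note eff = force_effect[OF force(3,4,5) wj u_def[symmetric]]
    have s: "fst s = X" and t: "fst t = X \<union> F" "snd t = Some u" using force u_def by auto
    have mono: "?f \<subseteq> full V r (X \<union> F)" by (rule full_mono) auto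
    have pre: "?f \<subseteq> A" "\<forall>v \<in> A - ?f. E `` {v} \<subseteq> ?f" using step.prems s by auto
    have uV: "u \<in> V" "u \<noteq> w" using eff(1) edges irr by auto
    show ?thesis
    proof (cases "E `` {w} \<subseteq> ?f")
      case True
      \<comment> \<open>The cluster game fills the isolated cluster of \<open>w\<close> at once,
        although this force colors just one of its vertices. Here \<open>A\<close> may run ahead, at
        no cost.\<close>
      have F: "F = {(w, j)}" using eff(5) True .
      have u: "u \<in> ?f" using True eff(1) edge_sym by auto
      have sub: "full V r (X \<union> F) \<subseteq> insert w ?f" using F by (fastforce simp: full_def cluster_def)
      have cong: "(\<Sum>v \<in> V - insert w A. card (cluster r v \<inter> fst t))
          = (\<Sum>v \<in> V - insert w A. card (cluster r v \<inter> X))"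
      proof (rule sum.cong[OF refl])
        fix v assume "v \<in> V - insert w A"
        then have "cluster r v \<inter> fst t = cluster r v \<inter> X"
          using t F by (auto simp: cluster_def)
        then show "card (cluster r v \<inter> fst t) = card (cluster r v \<inter> X)" by simp
      qed
      have "full V r (fst t) \<subseteq> insert w A" "insert w A \<subseteq> V"
          "\<forall>v \<in> insert w A - full V r (fst t). E `` {v} \<subseteq> full V r (fst t)"
          "\<forall>u. snd t = Some u \<longrightarrow> u \<in> insert w A"
      proof -
        show "\<forall>v \<in> insert w A - full V r (fst t). E `` {v} \<subseteq> full V r (fst t)"
        proof
          fix v assume "v \<in> insert w A - full V r (fst t)"
          then have "v = w \<or> v \<in> A - ?f" using mono t by auto
          then have "E `` {v} \<subseteq> ?f" using True pre by auto
          then show "E `` {v} \<subseteq> full V r (fst t)" using mono t by auto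
        qed
      qed (use sub pre t u step.prems(2) eff(2) in auto)
      from step.IH[OF this] obtain S L where SL: "S \<subseteq> V - insert w A" "L \<subseteq> V - insert w A"
        "S \<inter> L = {}" "cluster_forcing V E L (insert w A \<union> S)"
        "r * card S + card L \<le> (\<Sum>v \<in> V - insert w A. card (cluster r v \<inter> X))"
        unfolding cong by blast
      have le: "(\<Sum>v \<in> V - insert w A. card (cluster r v \<inter> X)) \<le> (\<Sum>v \<in> V - A. card (cluster r v \<inter> X))"
        by (rule sum_mono2) (use fin in auto)
      have "cluster_forcing V E L (A \<union> S)"
      proof (cases "w \<in> A")
        case True
        then show ?thesis using SL(4) by (simp add: insert_absorb)
      next
        case False
        show ?thesis
        proof (rule cluster_forcing.step[of u _ _ w])
          have "v = w" if wv: "(w, v) \<in> reach (V - (A \<union> S)) E" for v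
          proof (rule ccontr)
            assume "v \<noteq> w"
            then obtain c where "c \<in> V - (A \<union> S)" "(w, c) \<in> E"
              using reach_nontrivial(1)[OF wv _ symE] by auto
            then show False using True pre by auto
          qed
          then show "E `` {u} \<inter> reach (V - (A \<union> S)) E `` {w} = {w}" using eff(1) by auto
          have "insert u (insert w (A \<union> S)) = insert w A \<union> S" using u pre by auto
          then show "cluster_forcing V E L (insert u (insert w (A \<union> S)))" using SL(4) by simp
        qed (use u pre eff(2) False SL in auto)
      qed
      moreover have "A \<noteq> {}" using u pre by auto
      ultimately show ?thesis
        using SL le s by (intro exI[of _ S] exI[of _ L]) auto
    next
      case False
      \<comment> \<open>\<open>D\<close> collects the clusters that the force completes.\<close>
      define D where "D = E `` {u} \<inter> reach (V - ?f) E `` {w}"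
      have F: "F = (\<Union>d\<in>D. cluster r d - X)" using eff(6) False unfolding D_def .
      have wD: "w \<in> D" using eff(1) by (simp add: D_def)
      obtain c where c: "(w, c) \<in> E" "c \<notin> ?f" using False by auto
      \<comment> \<open>Clusters on which \<open>A\<close> is ahead have only full neighbours,
        whereas those of \<open>D\<close> lie in a component with an edge. So the blue vertices in
        \<open>D\<close> still count in the budget outside \<open>A\<close>.\<close>
      have Disj: "D \<inter> A = {}"
      proof (rule ccontr)
        assume "D \<inter> A \<noteq> {}"
        then obtain d where d: "d \<in> D" "d \<in> A" by auto
        have "d \<notin> ?f \<and> (\<exists>c. (d, c) \<in> E \<and> c \<notin> ?f)"
        proof (cases "d = w")
          case True then show ?thesis using c eff(2) by auto
        next
          case False
          then show ?thesis
            using reach_nontrivial(2,4)[of w d E "V - ?f"] d symE by (auto simp: D_def)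
        qed
        then show False using pre d by auto
      qed
      have DV: "D \<subseteq> V" using edges by (auto simp: D_def)
      have finD: "finite D" using DV fin finite_subset by auto
      have uD: "u \<notin> D" using irr by (auto simp: D_def)
      define A' where "A' = A \<union> insert u D"
      have sub: "full V r (X \<union> F) \<subseteq> ?f \<union> D"
        unfolding F by (fastforce simp: full_def cluster_def)
      have sup: "?f \<union> D \<subseteq> full V r (X \<union> F)"
        using mono DV unfolding F by (auto simp: full_def)
      \<comment> \<open>If \<open>u\<close> is not full, it lies in the component of
        \<open>w\<close>, so its neighbours that are not full belong to \<open>D\<close>. After the
        force \<open>u\<close> is isolated, which allows it in \<open>A'\<close> before any
        backforcing.\<close>
      have Nu: "E `` {u} \<subseteq> ?f \<union> D" if "u \<notin> ?f"
      proof
        fix n assume n: "n \<in> E `` {u}"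
        show "n \<in> ?f \<union> D"
        proof (cases "n \<in> ?f")
          case False
          have "(w, u) \<in> Restr E (V - ?f)" "(u, n) \<in> Restr E (V - ?f)"
            using eff(1,2) edge_sym edges n False that uV by auto
          then have "(w, n) \<in> reach (V - ?f) E" by (meson r_into_rtrancl rtrancl_into_rtrancl)
          then show ?thesis using n by (auto simp: D_def)
        qed auto
      qed
      have cong: "(\<Sum>v \<in> V - A'. card (cluster r v \<inter> fst t)) = (\<Sum>v \<in> V - A'. card (cluster r v \<inter> X))"
      proof (rule sum.cong[OF refl])
        fix v assume "v \<in> V - A'"
        then have "cluster r v \<inter> fst t = cluster r v \<inter> X"
          using t F by (auto simp: cluster_def A'_def)
        then show "card (cluster r v \<inter> fst t) = card (cluster r v \<inter> X)" by simp
      qed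
      have inv: "full V r (fst t) \<subseteq> A'" "A' \<subseteq> V"
          "\<forall>v \<in> A' - full V r (fst t). E `` {v} \<subseteq> full V r (fst t)"
          "\<forall>u. snd t = Some u \<longrightarrow> u \<in> A'"
      proof -
        show "full V r (fst t) \<subseteq> A'" using sub pre t by (auto simp: A'_def)
        show "A' \<subseteq> V" using step.prems(2) uV DV by (auto simp: A'_def)
        show "\<forall>u. snd t = Some u \<longrightarrow> u \<in> A'" using t by (auto simp: A'_def)
        show "\<forall>v \<in> A' - full V r (fst t). E `` {v} \<subseteq> full V r (fst t)"
        proof
          fix v assume "v \<in> A' - full V r (fst t)"
          then consider "v \<in> A - ?f" | "v = u" "u \<notin> ?f" using sup t by (auto simp: A'_def)
          then have "E `` {v} \<subseteq> ?f \<union> D" using Nu pre by cases auto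
          then show "E `` {v} \<subseteq> full V r (fst t)" using sup t by auto
        qed
      qed
      from step.IH[OF inv] obtain S L where SL: "S \<subseteq> V - A'" "L \<subseteq> V - A'"
        "S \<inter> L = {}" "cluster_forcing V E L (A' \<union> S)"
        "r * card S + card L \<le> (\<Sum>v \<in> V - A'. card (cluster r v \<inter> X))"
        unfolding cong by blast
      \<comment> \<open>Making all of \<open>D\<close> except \<open>w\<close> full from the start
        leaves \<open>w\<close> as the only target of \<open>u\<close>; \<open>u\<close> itself gets
        a One unless it lies in \<open>A\<close>.\<close>
      define S' where "S' = S \<union> (D - {w})"
      define L' where "L' = L \<union> ({u} - A)"
      have sub': "S' \<subseteq> V - A" "L' \<subseteq> V - A" "S' \<inter> L' = {}"
        using SL DV Disj uD uV by (auto simp: S'_def L'_def A'_def)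
      have "cluster_forcing V E L' (A \<union> S')"
      proof (rule cluster_forcing.step[of u _ _ w])
        show "u \<in> A \<union> S' \<union> L'" by (auto simp: L'_def)
        show "w \<in> V - (A \<union> S')" using wD DV Disj SL(1) by (auto simp: S'_def A'_def)
        have "reach (V - (A \<union> S')) E \<subseteq> reach (V - ?f) E"
          by (rule rtrancl_mono) (use pre in auto)
        then have "E `` {u} \<inter> reach (V - (A \<union> S')) E `` {w} \<subseteq> D" by (auto simp: D_def)
        moreover have "d = w" if "d \<in> D" "(w, d) \<in> reach (V - (A \<union> S')) E" for d
        proof (rule ccontr)
          assume "d \<noteq> w"
          then show False using reach_nontrivial(4)[OF that(2) _ symE] that(1) by (auto simp: S'_def)
        qed
        ultimately show "E `` {u} \<inter> reach (V - (A \<union> S')) E `` {w} = {w}" using eff(1) by auto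
        have "insert u (insert w (A \<union> S')) = A' \<union> S" using wD by (auto simp: A'_def S'_def)
        then show "cluster_forcing V E L' (insert u (insert w (A \<union> S')))"
          using cluster_forcing_mono[OF SL(4), of L'] by (simp add: L'_def)
      qed
      moreover have "r * card S' + card L' \<le> (\<Sum>v \<in> V - A. card (cluster r v \<inter> X))"
      proof -
        have finS: "finite S" "finite L" using SL fin by (auto intro: finite_subset)
        have cS: "card S' = card S + (card D - 1)"
          unfolding S'_def using SL(1) finS finD wD
          by (subst card_Un_disjoint) (auto simp: A'_def)
        have cL: "card L' = card L + card ({u} - A)"
          unfolding L'_def using SL(2) finS by (subst card_Un_disjoint) (auto simp: A'_def)
        have "card F = (\<Sum>d\<in>D. card (cluster r d - X))"
          unfolding F using finD by (subst card_UN_disjoint) (auto simp: cluster_def)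
        then have "(\<Sum>d\<in>D. card (cluster r d - X)) \<le> r" using force by simp
        moreover have "(\<Sum>d\<in>D. card (cluster r d - X)) + (\<Sum>d\<in>D. card (cluster r d \<inter> X)) = card D * r"
        proof -
          have "card (cluster r d - X) + card (cluster r d \<inter> X) = r" for d
            using card_Diff_subset_Int[of "cluster r d" X] card_mono[of "cluster r d" "cluster r d \<inter> X"]
            by auto
          then show ?thesis by (simp flip: sum.distrib)
        qed
        ultimately have D: "r * (card D - 1) \<le> (\<Sum>d\<in>D. card (cluster r d \<inter> X))"
          by (simp add: right_diff_distrib' mult.commute)
        \<comment> \<open>The forcing vertex \<open>x\<close> is blue and pays for the One of
          \<open>u\<close>.\<close>
        have u: "card ({u} - A) \<le> (\<Sum>v \<in> {u} - A. card (cluster r v \<inter> X))"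
        proof (cases "u \<in> A")
          case False
          have "x \<in> cluster r u \<inter> X" using eff(3) force by auto
          then have "0 < card (cluster r u \<inter> X)" by (auto simp: card_gt_0_iff)
          then show ?thesis using False by (simp add: insert_Diff_if)
        qed auto
        \<comment> \<open>The payments for the later game, for \<open>D\<close> and for
          \<open>u\<close> come from disjoint sets of clusters.\<close>
        have split: "V - A = (V - A') \<union> (D \<union> ({u} - A))"
          using DV Disj uV by (auto simp: A'_def)
        have "(\<Sum>v \<in> V - A. card (cluster r v \<inter> X)) = (\<Sum>v \<in> V - A'. card (cluster r v \<inter> X))
            + ((\<Sum>v \<in> D. card (cluster r v \<inter> X)) + (\<Sum>v \<in> {u} - A. card (cluster r v \<inter> X)))"
          unfolding split using fin finD uD
          by (subst sum.union_disjoint; (subst sum.union_disjoint)?) (auto simp: A'_def)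
        then show ?thesis using cS cL D u SL(5) by (simp add: distrib_left)
      qed
      \<comment> \<open>With \<open>A\<close> empty, \<open>u\<close> needs a One; this settles the
        borderline case of the count for \<open>r = card V\<close>.\<close>
      moreover have "A = {} \<longrightarrow> L' \<noteq> {}" by (auto simp: L'_def)
      ultimately show ?thesis using sub' s by blast
    qed
  qed
qed

section \<open>The cluster number and bounds for each \<open>r\<close>\<close>

text \<open>Taking \<open>L = V\<close> makes the Ones free: there are at most \<open>card V\<close>
  of them, whatever \<open>r\<close> is.\<close>

definition cluster_number :: nat where
  "cluster_number = (LEAST k. \<exists>S\<subseteq>V. card S = k \<and> cluster_forcing V E V S)"

lemma cluster_number_le:
  assumes "cluster_forcing V E L S" "S \<subseteq> V" "L \<subseteq> V"
  shows "cluster_number \<le> card S"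
proof -
  have "\<exists>T\<subseteq>V. card T = card S \<and> cluster_forcing V E V T"
    using cluster_forcing_mono[OF assms(1,3)] assms(2) by (intro exI[of _ S]) simp
  then show ?thesis unfolding cluster_number_def by (rule Least_le)
qed

lemma cluster_number_attained:
  obtains S where "S \<subseteq> V" "card S = cluster_number" "cluster_forcing V E V S"
proof -
  have "\<exists>k. \<exists>S\<subseteq>V. card S = k \<and> cluster_forcing V E V S"
    using cluster_forcing.finished by blast
  from LeastI_ex[OF this] show thesis using that unfolding cluster_number_def by blast
qed

lemma finite_psd_forcing_sets: "finite {B. psd_forcing_set V E r B}"
  by (rule finite_subset[of _ "Pow (blowup_verts V r)"])
    (auto simp: psd_forcing_set_def finite_blowup_verts)

lemma psd_forcing_number_le: "psd_forcing_set V E r B \<Longrightarrow> psd_forcing_number V E r \<le> card B"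
  unfolding psd_forcing_number_def by (rule Min_le) (auto simp: finite_psd_forcing_sets)

lemma psd_forcing_number_attained:
  obtains B where "psd_forcing_set V E r B" "card B = psd_forcing_number V E r"
proof -
  have "psd_forcing_set V E r (blowup_verts V r)" by (auto simp: psd_forcing_set_def)
  then have "psd_forcing_number V E r \<in> card ` {B. psd_forcing_set V E r B}"
    unfolding psd_forcing_number_def by (intro Min_in) (auto simp: finite_psd_forcing_sets)
  then show thesis using that by auto
qed

lemma card_split_full:
  assumes "B \<subseteq> blowup_verts V r"
  shows "card B = r * card (full V r B) + (\<Sum>v \<in> V - full V r B. card (cluster r v \<inter> B))"
proof -
  have "(\<Sum>v \<in> full V r B. card (cluster r v \<inter> B)) = (\<Sum>v \<in> full V r B. r)"
    by (rule sum.cong) (auto simp: full_def Int_absorb2)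
  then show ?thesis
    unfolding card_eq_sum_clusters[OF assms] sum.subset_diff[OF full_subset fin, of _ r B] by simp
qed

text \<open>The simulation starts with the clusters full in \<open>B\<close> as \<open>A\<close>.
  Those it adds become All clusters too, paid for by the blue vertices in the remaining
  clusters.\<close>

lemma psd_forcing_set_reduce:
  assumes "psd_forcing_set V E r B"
  obtains S L where "S \<subseteq> V" "L \<subseteq> V" "S \<inter> L = {}" "cluster_forcing V E L S"
    "r * card S + card L \<le> card B" "full V r B = {} \<Longrightarrow> V = {} \<or> L \<noteq> {}"
proof -
  let ?A = "full V r B"
  obtain q where B: "B \<subseteq> blowup_verts V r" "(psd_step V E r)\<^sup>*\<^sup>* (B, None) (blowup_verts V r, q)"
    using assms by (auto simp: psd_forcing_set_def)
  obtain S L where SL: "S \<subseteq> V - ?A" "L \<subseteq> V - ?A" "S \<inter> L = {}" "cluster_forcing V E L (?A \<union> S)"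
      "r * card S + card L \<le> (\<Sum>v \<in> V - ?A. card (cluster r v \<inter> B))" "?A = {} \<longrightarrow> V = {} \<or> L \<noteq> {}"
    using process_to_cluster_forcing[OF B(2), of ?A, unfolded fst_conv snd_conv, OF subset_refl full_subset]
    by (elim meta_impE exE conjE) simp_all
  have "card (?A \<union> S) = card ?A + card S"
    using SL(1) fin full_subset[of V r B] by (intro card_Un_disjoint) (auto intro: finite_subset)
  then have "r * card (?A \<union> S) + card L \<le> card B"
    using SL(5) card_split_full[OF B(1)] by (simp add: distrib_left)
  then show thesis using that[of "?A \<union> S" L] SL full_subset[of V r B] by blast
qed

text \<open>The clusters of \<open>S\<close> are filled and those of \<open>L\<close> get the vertex
  of index \<open>0\<close>; disjointness of \<open>S\<close> and \<open>L\<close> makes the count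
  exact.\<close>

lemma aon_realisation:
  assumes "S \<subseteq> V" "L \<subseteq> V" "S \<inter> L = {}" "cluster_forcing V E L S" "2 \<le> r \<or> r = card V"
  obtains B where "aon_psd_forcing_set V E r B" "card B = r * card S + card L"
    "\<exists>q. (single_cluster_step V E r)\<^sup>*\<^sup>* (B, None) (blowup_verts V r, q)"
proof -
  let ?B = "S \<times> {..<r} \<union> L \<times> {0}"
  obtain q where q: "(single_cluster_step V E r)\<^sup>*\<^sup>* (?B, None) (blowup_verts V r, q)"
    using cluster_forcing_to_process[OF assms(4,1,2,5)] by blast
  have r: "V = {} \<or> 0 < r" using assms(5) fin by (auto simp: card_gt_0_iff)
  then have "?B \<subseteq> blowup_verts V r" using assms by (auto simp: blowup_verts_eq)
  then have forcing: "psd_forcing_set V E r ?B"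
    using single_cluster_psd[OF q] by (auto simp: psd_forcing_set_def)
  have "all_cluster r ?B u \<or> one_cluster r ?B u \<or> none_cluster r ?B u" if "u \<in> V" for u
  proof -
    consider "u \<in> S" | "u \<in> L" "u \<notin> S" | "u \<notin> S \<union> L" by blast
    then show ?thesis
    proof cases
      case 2
      then have "cluster r u \<inter> ?B = {(u, 0)}" using r that by (auto simp: cluster_def)
      then show ?thesis by (simp add: one_cluster_def)
    qed (auto simp: all_cluster_def none_cluster_def cluster_def)
  qed
  then have "aon_psd_forcing_set V E r ?B" using forcing by (auto simp: aon_psd_forcing_set_def)
  moreover have "card ?B = r * card S + card L"
    using assms(1-3) fin
    by (subst card_Un_disjoint) (auto simp: card_cartesian_product intro: finite_subset)
  ultimately show thesis using that q by blast
qed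

text \<open>A minimum forcing set reduces to some \<open>S\<close> and \<open>L\<close>; dropping
  the cost of \<open>L\<close> and allowing every One makes \<open>S\<close> a candidate for
  \<open>cluster_number\<close>.\<close>

lemma psd_forcing_number_ge: "r * cluster_number \<le> psd_forcing_number V E r"
proof -
  obtain B where B: "psd_forcing_set V E r B" "card B = psd_forcing_number V E r"
    by (rule psd_forcing_number_attained)
  obtain S L where SL: "S \<subseteq> V" "L \<subseteq> V" "cluster_forcing V E L S" "r * card S + card L \<le> card B"
    using psd_forcing_set_reduce[OF B(1)] by metis
  have "r * cluster_number \<le> r * card S" using cluster_number_le[OF SL(3,1,2)] by simp
  then show ?thesis using SL B by linarith
qed

lemma psd_forcing_number_le_cluster_forcing:
  assumes "S \<subseteq> V" "L \<subseteq> V" "S \<inter> L = {}" "cluster_forcing V E L S" "2 \<le> r \<or> r = card V"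
  shows "psd_forcing_number V E r \<le> r * card S + card L"
  using aon_realisation[OF assms] psd_forcing_number_le by (metis aon_psd_forcing_set_def)

text \<open>Some vertex can do without a One: any vertex of \<open>S\<close>, or, if
  \<open>S\<close> is empty, the target of the first force, which that step makes full. Strictness
  is what separates consecutive numbers of All clusters when \<open>r = card V\<close>.\<close>

lemma psd_forcing_number_less:
  assumes "2 \<le> r \<or> r = card V" "V \<noteq> {}"
  shows "psd_forcing_number V E r < r * cluster_number + card V"
proof -
  obtain S where S: "S \<subseteq> V" "card S = cluster_number" "cluster_forcing V E V S"
    by (rule cluster_number_attained)
  obtain L where L: "L \<subset> V" "S \<inter> L = {}" "cluster_forcing V E L S"
  proof (cases "S = {}")
    case False
    then show ?thesis using that[of "V - S"] cluster_forcing_Diff[OF S(3) subset_refl] S(1) by blast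
  next
    case True
    from S(3) show ?thesis
    proof cases
      case (step u w)
      have u: "u \<noteq> w" "u \<in> V" using step(3) irr edges by auto
      have "cluster_forcing V E (V - {w}) S"
      proof (rule cluster_forcing.step[OF _ step(2,3)])
        show "u \<in> S \<union> (V - {w})" using u by simp
        show "cluster_forcing V E (V - {w}) (insert u (insert w S))"
          by (rule cluster_forcing_Diff[OF step(4)]) simp
      qed
      then show ?thesis using that[of "V - {w}"] True step(2) by auto
    qed (use True assms(2) in auto)
  qed
  have "psd_forcing_number V E r \<le> r * card S + card L"
    using psd_forcing_number_le_cluster_forcing[OF S(1) _ L(2,3) assms(1)] L(1) by auto
  then show ?thesis using psubset_card_mono[OF fin L(1)] S(2) by simp
qed

section \<open>Optimal AON sets and the fractional number\<close>

text \<open>Reducing a minimum forcing set and realising the result cannot lower the cardinality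
  further, so the AON set obtained is optimal.\<close>

lemma optimal_exists: "\<exists>B. optimal_aon_psd_forcing_set V E (card V) B"
proof -
  let ?n = "card V"
  obtain B where B: "psd_forcing_set V E ?n B" "card B = psd_forcing_number V E ?n"
    by (rule psd_forcing_number_attained)
  obtain S L where SL: "S \<subseteq> V" "L \<subseteq> V" "S \<inter> L = {}" "cluster_forcing V E L S"
      "?n * card S + card L \<le> card B"
    using psd_forcing_set_reduce[OF B(1)] by metis
  obtain B' where B': "aon_psd_forcing_set V E ?n B'" "card B' = ?n * card S + card L"
      "\<exists>q. (single_cluster_step V E ?n)\<^sup>*\<^sup>* (B', None) (blowup_verts V ?n, q)"
    using aon_realisation[OF SL(1-4)] by metis
  have "psd_forcing_number V E ?n \<le> card B'"
    using psd_forcing_number_le B'(1) by (auto simp: aon_psd_forcing_set_def)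
  then show ?thesis using B B' SL unfolding optimal_aon_psd_forcing_set_def by (intro exI[of _ B']) auto
qed

text \<open>For nonempty \<open>V\<close> the strict upper bound gives
  \<open>?a \<le> cluster_number\<close>. If \<open>?a\<close> were smaller, the lower bound would
  force \<open>?n \<le> ?l\<close>, hence \<open>?a = 0\<close> and \<open>?l = ?n\<close>. The
  reduction then uses a One, so fewer than \<open>?n\<close> blue vertices remain for
  \<open>S\<close>, which is thus empty, contradicting \<open>0 < cluster_number\<close>.\<close>

lemma num_all_optimal:
  assumes "optimal_aon_psd_forcing_set V E (card V) B"
  shows "num_all V (card V) B = cluster_number"
proof -
  let ?n = "card V" and ?a = "card (full V (card V) B)"
  let ?l = "\<Sum>v \<in> V - full V (card V) B. card (cluster (card V) v \<inter> B)"
  have B: "psd_forcing_set V E ?n B" "card B = psd_forcing_number V E ?n"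
    and aon: "\<forall>u\<in>V. all_cluster ?n B u \<or> one_cluster ?n B u \<or> none_cluster ?n B u"
    using assms by (auto simp: optimal_aon_psd_forcing_set_def aon_psd_forcing_set_def)
  \<comment> \<open>A cluster of an AON set that is not full has at most one blue vertex.\<close>
  have "?l \<le> (\<Sum>v \<in> V - full V ?n B. 1)"
    by (rule sum_mono)
      (use aon in \<open>auto simp: full_def all_cluster_def one_cluster_def none_cluster_def\<close>)
  also have "\<dots> = ?n - ?a" 
    using card_Diff_subset[OF finite_subset[OF full_subset fin] full_subset] by simp
  finally have l: "?l + ?a \<le> ?n"
    using card_mono[OF fin full_subset[of V ?n B]] by simp
  have Z: "psd_forcing_number V E ?n = ?n * ?a + ?l"
    using card_split_full[of B ?n] B by (auto simp: psd_forcing_set_def)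
  have "?a = cluster_number"
  proof (cases "V = {}")
    case True
    then show ?thesis using cluster_number_le[of V V] cluster_forcing.finished[of V E V]
      full_subset[of V ?n B] by simp
  next
    case False
    then have "?n * ?a < ?n * Suc cluster_number"
      using psd_forcing_number_less[of ?n] Z by simp
    then have "?a \<le> cluster_number" by (simp only: mult_less_cancel1 less_Suc_eq_le)
    moreover have "\<not> ?a < cluster_number"
    proof
      assume less: "?a < cluster_number"
      then have "?n * Suc ?a \<le> ?n * cluster_number" by (intro mult_le_mono) auto
      then have "?n \<le> ?l" using psd_forcing_number_ge[of ?n] Z by simp
      then have a: "?a = 0" "?l = ?n" using l by auto
      then have "full V ?n B = {}" 
        using finite_subset[OF full_subset fin, of ?n B] by simp
      then obtain S L where SL: "S \<subseteq> V" "L \<subseteq> V" "cluster_forcing V E L S"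
          "?n * card S + card L \<le> card B" "L \<noteq> {}"
        using psd_forcing_set_reduce[OF B(1)] False by metis
      have "0 < card L" using SL fin by (auto simp: card_gt_0_iff intro: finite_subset)
      moreover have "card B = ?n" using B(2) Z a by simp
      ultimately have "?n * card S < ?n * 1" using SL(4) by linarith
      then have "card S < 1" unfolding mult_less_cancel1 ..
      then show False using cluster_number_le[OF SL(3,1,2)] less by simp
    qed
    ultimately show ?thesis by simp
  qed
  then show ?thesis by (simp add: num_all_def full_def all_cluster_def)
qed

lemma a_star_eq: "a_star V E = cluster_number"
  unfolding a_star_def using optimal_exists num_all_optimal by (intro the_equality) auto

text \<open>Every quotient is at least \<open>cluster_number\<close>, and for
  \<open>2 \<le> r\<close> it exceeds this by at most \<open>card V / r\<close>.\<close>

lemma fractional_psd_forcing_number_eq: "fractional_psd_forcing_number V E = real cluster_number"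
proof (rule antisym)
  let ?Z = "\<lambda>r. real (psd_forcing_number V E r) / real r"
  have bdd: "bdd_below (?Z ` {1..})" by (rule bdd_belowI[of _ 0]) auto
  show "fractional_psd_forcing_number V E \<le> real cluster_number"
  proof (rule field_le_epsilon)
    fix e :: real assume e: "0 < e"
    obtain k :: nat where k: "real (card V) / e \<le> real k" using real_arch_simple by blast
    \<comment> \<open>The summand \<open>2\<close> meets the hypothesis of the upper bound, and
      \<open>k\<close> makes \<open>card V / r\<close> at most \<open>e\<close>.\<close>
    define r where "r = k + 2"
    have "psd_forcing_number V E r \<le> r * cluster_number + card V"
    proof (cases "V = {}")
      case True
      then show ?thesis
        using psd_forcing_number_le_cluster_forcing[OF _ _ _ cluster_forcing.finished, of "{}" r]
        by (simp add: r_def)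
    next
      case False
      then show ?thesis using psd_forcing_number_less[of r] by (simp add: r_def)
    qed
    then have "real (psd_forcing_number V E r) \<le> real (r * cluster_number + card V)"
      by (rule of_nat_mono)
    also have "\<dots> \<le> real r * real cluster_number + e * real r"
      using k e by (simp add: r_def field_simps)
    finally have "?Z r \<le> real cluster_number + e" by (simp add: r_def field_simps)
    moreover have "fractional_psd_forcing_number V E \<le> ?Z r"
      unfolding fractional_psd_forcing_number_def by (rule cINF_lower[OF bdd]) (simp add: r_def)
    ultimately show "fractional_psd_forcing_number V E \<le> real cluster_number + e" by linarith
  qed
  show "real cluster_number \<le> fractional_psd_forcing_number V E"
    unfolding fractional_psd_forcing_number_def
  proof (rule cINF_greatest)
    fix r :: nat assume r: "r \<in> {1..}"
    have "real (r * cluster_number) \<le> real (psd_forcing_number V E r)"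
      using psd_forcing_number_ge by (rule of_nat_mono)
    then show "real cluster_number \<le> ?Z r" using r by (simp add: field_simps)
  qed simp
qed

end

theorem theorem2p17:
  fixes V :: "'a set" and E :: "'a rel"
  assumes "simple_graph V E"
  shows "fractional_psd_forcing_number V E = real (a_star V E)"
proof -
  interpret sgraph V E by unfold_locales (rule assms)
  show ?thesis by (simp add: fractional_psd_forcing_number_eq a_star_eq)
qed

end
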